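(* Let $m\geq 1$ and $d\geq 1$. Let $f:[0,4]\to(-\infty,\infty]$ be a function that is finite and continuous on $(0,4]$ with $f(0)=\lim_{t\to 0^+}f(t)$, and differentiable on $(0,4)$ with the derivative $f^{(2m-1)}$ existing and concave on $(0,4)$. If $\omega_N=\{\mathbf x_1,\ldots,\mathbf x_N\}\subset S^d$ is a strongly $m$-sharp configuration, then the potential $$p_f(\mathbf x,\omega_N)=\sum_{i=1}^N f(|\mathbf x-\mathbf x_i|^2),\qquad \mathbf x\in S^d,$$ attains its absolute minimum over $S^d$ at every point of $-\omega_N=\{-\mathbf x_1,\dots,-\mathbf x_N\}$. If the concavity of $f^{(2m-1)}$ on $(0,4)$ is strict, then every point of absolute minimum of $p_f(\cdot,\omega_N)$ over $S^d$ belongs to $-\omega_N$.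
   Context: $S^d=\{\mathbf x\in\mathbb R^{d+1}:|\mathbf x|=1\}$ with normalized surface measure $\sigma_d$. A configuration $\omega_N=\{\mathbf x_1,\dots,\mathbf x_N\}\subset S^d$ is a spherical $n$-design if $\frac1N\sum_{i=1}^N q(\mathbf x_i)=\int_{S^d}q\,d\sigma_d$ for every polynomial $q$ on $\mathbb R^{d+1}$ of degree at most $n$. A configuration is $m$-sharp ($m\ge1$) if it is a spherical $(2m-1)$-design and there are exactly $m$ distinct values of the dot product between distinct points of the configuration; it is strongly $m$-sharp if it is $m$-sharp and moreover a spherical $2m$-design. *)

theory Defs
  imports "HOL-Analysis.Analysis"
begin

text \<open>
  The normalized surface measure on the unit sphere, as the cone measure: the image of the
  uniform distribution on the unit ball under the radial projection \<^term>\<open>sgn\<close>, so that the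
  measure of \<open>A\<close> is the volume of the cone \<open>{r *\<^sub>R x | x \<in> A, 0 < r < 1}\<close> divided by that
  of the ball. The single point \<open>0\<close>, which \<^term>\<open>sgn\<close> does not send to the sphere, is a null set.
\<close>

definition sphere_measure :: "(real ^ 'n) measure" where
  "sphere_measure =
     restrict_space (distr (uniform_measure lborel (ball 0 1)) borel sgn) (sphere 0 1)"

definition poly_fun_le :: "nat \<Rightarrow> (real ^ 'n \<Rightarrow> real) \<Rightarrow> bool" where
  "poly_fun_le n q \<longleftrightarrow>
     (\<exists>c :: ('n \<Rightarrow> nat) \<Rightarrow> real.
        q = (\<lambda>x. \<Sum>\<alpha> | (\<Sum>i\<in>UNIV. \<alpha> i) \<le> n. c \<alpha> * (\<Prod>i\<in>UNIV. (x $ i) ^ \<alpha> i)))"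

definition spherical_design :: "nat \<Rightarrow> (real ^ 'n) set \<Rightarrow> bool" where
  "spherical_design n \<omega> \<longleftrightarrow>
     finite \<omega> \<and> \<omega> \<noteq> {} \<and> \<omega> \<subseteq> sphere 0 1 \<and>
     (\<forall>q. poly_fun_le n q \<longrightarrow>
        (1 / real (card \<omega>)) * (\<Sum>x\<in>\<omega>. q x) = (\<integral>x. q x \<partial>sphere_measure))"

definition sharp_config :: "nat \<Rightarrow> (real ^ 'n) set \<Rightarrow> bool" where
  "sharp_config m \<omega> \<longleftrightarrow>
     1 \<le> m \<and> spherical_design (2 * m - 1) \<omega> \<and>
     card {x \<bullet> y | x y. x \<in> \<omega> \<and> y \<in> \<omega> \<and> x \<noteq> y} = m"

definition strongly_sharp_config :: "nat \<Rightarrow> (real ^ 'n) set \<Rightarrow> bool" where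
  "strongly_sharp_config m \<omega> \<longleftrightarrow> sharp_config m \<omega> \<and> spherical_design (2 * m) \<omega>"

definition potential :: "(real \<Rightarrow> ereal) \<Rightarrow> (real ^ 'n) set \<Rightarrow> real ^ 'n \<Rightarrow> ereal" where
  "potential f \<omega> x = (\<Sum>y\<in>\<omega>. f ((norm (x - y))\<^sup>2))"

definition strictly_concave_on :: "'a::real_vector set \<Rightarrow> ('a \<Rightarrow> real) \<Rightarrow> bool" where
  "strictly_concave_on S g \<longleftrightarrow>
     convex S \<and>
     (\<forall>x\<in>S. \<forall>y\<in>S. \<forall>u>0. \<forall>v>0. x \<noteq> y \<longrightarrow> u + v = 1 \<longrightarrow>
        u * g x + v * g y < g (u *\<^sub>R x + v *\<^sub>R y))"


text \<open>
  The index set in \<^const>\<open>poly_fun_le\<close> is finite (so the sum is the intended one), and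
  \<^const>\<open>sphere_measure\<close> is a rotation invariant probability measure on the sphere.
\<close>

lemma finite_multi_indices: "finite {\<alpha> :: 'n::finite \<Rightarrow> nat. (\<Sum>i\<in>UNIV. \<alpha> i) \<le> n}"
proof (rule finite_subset)
  show "{\<alpha> :: 'n \<Rightarrow> nat. (\<Sum>i\<in>UNIV. \<alpha> i) \<le> n} \<subseteq> (UNIV :: 'n set) \<rightarrow>\<^sub>E {..n}"
  proof
    fix \<alpha> :: "'n \<Rightarrow> nat" assume "\<alpha> \<in> {\<alpha>. (\<Sum>i\<in>UNIV. \<alpha> i) \<le> n}"
    moreover have "\<alpha> i \<le> (\<Sum>i\<in>UNIV. \<alpha> i)" for i
      by (rule member_le_sum) auto
    ultimately have "\<alpha> i \<le> n" for i
      using order_trans by blast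
    then show "\<alpha> \<in> UNIV \<rightarrow>\<^sub>E {..n}"
      by (simp add: PiE_UNIV_domain)
  qed
  show "finite ((UNIV :: 'n set) \<rightarrow>\<^sub>E {..n})"
    by (intro finite_PiE) auto
qed

lemma space_sphere_measure: "space (sphere_measure :: (real ^ 'n) measure) = sphere 0 1"
  by (simp add: sphere_measure_def space_restrict_space)

lemma sets_sphere_measure:
  "sets (sphere_measure :: (real ^ 'n) measure) = sets (restrict_space borel (sphere 0 1))"
  unfolding sphere_measure_def by (rule sets_restrict_space_cong) simp

lemma emeasure_sphere_measure:
  fixes A :: "(real ^ 'n) set"
  assumes "A \<in> sets borel" "A \<subseteq> sphere 0 1"
  shows "emeasure sphere_measure A =
    emeasure lborel {x \<in> ball 0 1. sgn x \<in> A} / emeasure lborel (ball 0 1 :: (real ^ 'n) set)"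
proof -
  have sgn [measurable]: "(sgn :: real ^ 'n \<Rightarrow> _) \<in> borel_measurable borel"
    unfolding sgn_div_norm[abs_def] by measurable
  have "emeasure sphere_measure A
      = emeasure (distr (uniform_measure lborel (ball 0 1)) borel sgn) A"
    unfolding sphere_measure_def using assms by (intro emeasure_restrict_space) auto
  also have "\<dots> = emeasure (uniform_measure lborel (ball 0 1)) (sgn -` A)"
    using assms by (subst emeasure_distr) auto
  also have "\<dots> = emeasure lborel (ball 0 1 \<inter> sgn -` A) / emeasure lborel (ball 0 1 :: (real ^ 'n) set)"
    using assms measurable_sets[OF sgn, of A] by (subst emeasure_uniform_measure) auto
  also have "ball 0 1 \<inter> sgn -` A = {x \<in> ball 0 1. sgn x \<in> A}"
    by auto
  finally show ?thesis .
qed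

lemma emeasure_unit_ball_pos_finite:
  "emeasure lborel (ball 0 1 :: (real ^ 'n) set) \<noteq> 0"
  "emeasure lborel (ball 0 1 :: (real ^ 'n) set) \<noteq> \<infinity>"
proof -
  show "emeasure lborel (ball 0 1 :: (real ^ 'n) set) \<noteq> 0"
  proof
    assume "emeasure lborel (ball 0 1 :: (real ^ 'n) set) = 0"
    then have "ball 0 1 \<in> null_sets (lborel :: (real ^ 'n) measure)"
      by (intro null_setsI) auto
    then have "negligible (ball 0 1 :: (real ^ 'n) set)"
      using negligible_iff_null_sets null_sets_completionI by blast
    then show False
      using open_not_negligible[of "ball 0 1 :: (real ^ 'n) set"] by simp
  qed
  show "emeasure lborel (ball 0 1 :: (real ^ 'n) set) \<noteq> \<infinity>"
    using emeasure_lborel_ball_finite by (metis infinity_ennreal_def less_irrefl)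
qed

lemma emeasure_sphere_measure_sphere:
  "emeasure (sphere_measure :: (real ^ 'n) measure) (sphere 0 1) = 1"
proof -
  let ?B = "ball 0 1 :: (real ^ 'n) set"
  have "{x \<in> ?B. sgn x \<in> sphere 0 1} = ?B - {0}"
    by (auto simp: norm_sgn)
  moreover have "emeasure lborel (?B - {0}) = emeasure lborel ?B"
    by (intro emeasure_Diff_null_set) (auto simp: null_sets_def)
  ultimately show ?thesis
    using emeasure_unit_ball_pos_finite[where 'n = 'n]
    by (subst emeasure_sphere_measure) (auto simp: ennreal_divide_self top.not_eq_extremum)
qed

lemma distr_lborel_orthogonal:
  fixes T :: "real ^ 'n \<Rightarrow> real ^ 'n"
  assumes "orthogonal_transformation T"
  shows "distr lborel borel T = lborel"
proof -
  let ?M = "distr lborel borel T" and ?B = "ball 0 1 :: (real ^ 'n) set"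
  have lin: "linear T"
    using assms by (rule orthogonal_transformation_linear)
  then have T [measurable]: "T \<in> borel_measurable borel"
    by (intro borel_measurable_continuous_onI linear_continuous_on)
       (simp add: linear_conv_bounded_linear)
  obtain S where S: "\<And>y. T (S y) = y"
    using orthogonal_transformation_surj[OF assms] by (metis surjD)
  have trans: "(\<integral>\<^sup>+x. h (x + y) \<partial>lborel) = (\<integral>\<^sup>+x. h x \<partial>lborel)"
    if [measurable]: "h \<in> borel_measurable borel" for h :: "real ^ 'n \<Rightarrow> ennreal" and y
  proof -
    have "(\<integral>\<^sup>+x. h x \<partial>lborel) = (\<integral>\<^sup>+x. h x \<partial>distr lborel borel ((+) y))"
      using lborel_distr_plus[of y] by simp
    also have "\<dots> = (\<integral>\<^sup>+x. h (x + y) \<partial>lborel)"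
      by (subst nn_integral_distr) (auto simp: add.commute)
    finally show ?thesis ..
  qed
  have transM: "(\<integral>\<^sup>+x. h (x + y) \<partial>?M) = (\<integral>\<^sup>+x. h x \<partial>?M)"
    if [measurable]: "h \<in> borel_measurable borel" for h :: "real ^ 'n \<Rightarrow> ennreal" and y
  proof -
    have "(\<integral>\<^sup>+x. h (x + y) \<partial>?M) = (\<integral>\<^sup>+x. h (T (x + S y)) \<partial>lborel)"
      by (subst nn_integral_distr) (auto simp: linear_add[OF lin] S)
    also have "\<dots> = (\<integral>\<^sup>+x. h (T x) \<partial>lborel)"
      by (rule trans) measurable
    also have "\<dots> = (\<integral>\<^sup>+x. h x \<partial>?M)"
      by (subst nn_integral_distr) auto
    finally show ?thesis .
  qed
  have MB: "emeasure ?M ?B = emeasure lborel ?B"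
  proof -
    have "T -` ?B = ?B"
      using orthogonal_transformation_norm[OF assms] by auto
    then show ?thesis
      by (subst emeasure_distr) auto
  qed
  have sf: "sigma_finite_measure ?M"
  proof
    let ?A = "(\<lambda>n. ball 0 (real n) :: (real ^ 'n) set) ` UNIV"
    have "T -` ball 0 r = ball 0 r" for r
      using orthogonal_transformation_norm[OF assms] by auto
    then have "emeasure ?M (ball 0 r) \<noteq> \<infinity>" for r
      using emeasure_lborel_ball_finite[of "0 :: real ^ 'n" r]
      by (subst emeasure_distr) auto
    moreover have "\<Union>?A = space ?M"
      by (auto simp: reals_Archimedean2)
    ultimately show "\<exists>A. countable A \<and> A \<subseteq> sets ?M \<and> \<Union>A = space ?M \<and> (\<forall>a\<in>A. emeasure ?M a \<noteq> \<infinity>)"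
      by (intro exI[of _ ?A]) auto
  qed
  interpret pair_sigma_finite lborel ?M
    using sf by (intro pair_sigma_finite.intro lborel.sigma_finite_measure_axioms)
  show ?thesis
  proof (rule measure_eqI)
    fix A assume "A \<in> sets ?M"
    then have A [measurable]: "A \<in> sets borel" by simp
    have B [measurable]: "?B \<in> sets borel" by simp
    have Fub: "(\<integral>\<^sup>+x. \<integral>\<^sup>+y. h x y \<partial>lborel \<partial>?M) = (\<integral>\<^sup>+y. \<integral>\<^sup>+x. h x y \<partial>?M \<partial>lborel)"
      if [measurable]: "case_prod h \<in> borel_measurable (borel \<Otimes>\<^sub>M borel)"
      for h :: "real ^ 'n \<Rightarrow> real ^ 'n \<Rightarrow> ennreal"
      by (rule Fubini'[of "\<lambda>x y. h y x", simplified]) measurable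
    have "emeasure ?M A * emeasure lborel ?B
        = (\<integral>\<^sup>+x. \<integral>\<^sup>+y. indicator A x * indicator ?B y \<partial>lborel \<partial>?M)"
      by (simp add: nn_integral_cmult nn_integral_multc)
    also have "\<dots> = (\<integral>\<^sup>+x. \<integral>\<^sup>+y. indicator A x * indicator ?B (y + - x) \<partial>lborel \<partial>?M)"
      by (subst trans[of "\<lambda>y. indicator A x * indicator ?B y" for x]) simp_all
    also have "\<dots> = (\<integral>\<^sup>+y. \<integral>\<^sup>+x. indicator A x * indicator ?B (y + - x) \<partial>?M \<partial>lborel)"
      by (rule Fub) measurable
    also have "\<dots> = (\<integral>\<^sup>+y. \<integral>\<^sup>+x. indicator A (x + y) * indicator ?B (y + - (x + y)) \<partial>?M \<partial>lborel)"
      by (subst transM[of "\<lambda>x. indicator A x * indicator ?B (y + - x)" for y]) simp_all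
    also have "\<dots> = (\<integral>\<^sup>+y. \<integral>\<^sup>+x. indicator ?B x * indicator A (y + x) \<partial>?M \<partial>lborel)"
      by (intro nn_integral_cong) (auto simp: indicator_def add.commute)
    also have "\<dots> = (\<integral>\<^sup>+x. \<integral>\<^sup>+y. indicator ?B x * indicator A (y + x) \<partial>lborel \<partial>?M)"
      by (rule Fub[symmetric]) measurable
    also have "\<dots> = (\<integral>\<^sup>+x. \<integral>\<^sup>+y. indicator ?B x * indicator A y \<partial>lborel \<partial>?M)"
      by (subst trans[of "\<lambda>y. indicator ?B x * indicator A y" for x]) simp_all
    also have "\<dots> = emeasure lborel A * emeasure lborel ?B"
      by (simp add: nn_integral_cmult nn_integral_multc MB mult.commute)
    finally show "emeasure ?M A = emeasure lborel A"
      using emeasure_unit_ball_pos_finite[where 'n = 'n]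
      by (auto simp: mult.commute[of _ "emeasure lborel ?B"] ennreal_mult_cancel_left top.not_eq_extremum)
  qed simp
qed

lemma sphere_measure_rotation_invariant:
  fixes T :: "real ^ 'n \<Rightarrow> real ^ 'n"
  assumes "orthogonal_transformation T" "A \<in> sets borel" "A \<subseteq> sphere 0 1"
  shows "emeasure sphere_measure (T -` A) = emeasure sphere_measure A"
proof -
  have norm: "norm (T x) = norm x" for x
    using assms(1) by (rule orthogonal_transformation_norm)
  have lin: "linear T"
    using assms(1) by (rule orthogonal_transformation_linear)
  then have T: "T \<in> borel_measurable borel"
    by (intro borel_measurable_continuous_onI linear_continuous_on)
       (simp add: linear_conv_bounded_linear)
  have sgnT: "sgn (T x) = T (sgn x)" for x
    using lin by (simp add: sgn_div_norm norm linear_scale)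
  have sgn: "(sgn :: real ^ 'n \<Rightarrow> _) \<in> borel_measurable borel"
    unfolding sgn_div_norm[abs_def] by measurable
  let ?C = "\<lambda>A. {x \<in> ball 0 1. sgn x \<in> A}"
  have C: "?C A \<in> sets borel"
  proof -
    have "?C A = ball 0 1 \<inter> sgn -` A" by auto
    then show ?thesis
      using measurable_sets[OF sgn assms(2)] by simp
  qed
  have "?C (T -` A) = T -` ?C A"
    by (auto simp: sgnT norm)
  moreover have "emeasure lborel (T -` ?C A) = emeasure (distr lborel borel T) (?C A)"
    using T C by (subst emeasure_distr) auto
  ultimately have "emeasure lborel (?C (T -` A)) = emeasure lborel (?C A)"
    using distr_lborel_orthogonal[OF assms(1)] by simp
  moreover have "T -` A \<in> sets borel"
    using measurable_sets[OF T assms(2)] by simp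
  moreover have "T -` A \<subseteq> sphere 0 1"
  proof
    fix x assume "x \<in> T -` A"
    then have "T x \<in> sphere 0 1" using assms(3) by auto
    then show "x \<in> sphere 0 1" by (simp add: norm)
  qed
  ultimately show ?thesis
    using assms by (simp add: emeasure_sphere_measure)
qed

end

(* In the variable t = |x - y|^2 the dot products of the configuration with a point of -omega become
   the number 4 and the m numbers 2 + 2a, a ranging over the inner products of distinct points.
   Let H be the polynomial of degree at most 2m that agrees with f at 4 and to second order at the
   numbers 2 + 2a. Rolle's theorem and the concavity of f^(2m-1) give f >= H on [0,4]. By the design
   property and rotation invariance, the sum of H(|x - y|^2) over y in omega does not depend on x,
   and at the points of -omega it equals the potential. The nodes 2 + 2a are interior, because -1 is
   not an inner product: otherwise (1 - t^2) times the product of the (t - a)^2, a different from -1,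
   would be a nonnegative polynomial of degree 2m with vanishing mean. In the same way the product of
   the (t + a)^2 excludes that z has all its dot products among the -a, so in the strict case the
   inequality is strict unless z is antipodal to a point of omega. *)
theory Submission
  imports Defs
begin

section \<open>Hermite interpolation\<close>

text \<open>Induction on the number of zeros, removing the largest one: Rolle's theorem in the gap
  between the two largest zeros gives the new point. The bound \<open>{..<Max X}\<close> keeps it
  apart from the points found before, and avoiding \<open>X\<close> lets double nodes be counted in
  addition later. Derivatives are required only in the interior, so zeros may sit at the ends of
  \<open>I\<close>.\<close>

lemma rolle_zeros:
  fixes \<phi> \<phi>' :: "real \<Rightarrow> real"
  assumes "convex I" "continuous_on I \<phi>"
    and "\<And>t. t \<in> interior I \<Longrightarrow> (\<phi> has_real_derivative \<phi>' t) (at t)"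
    and "finite X" "card X = Suc n" "X \<subseteq> I" "\<And>x. x \<in> X \<Longrightarrow> \<phi> x = 0"
  shows "\<exists>Y \<subseteq> interior I \<inter> {..<Max X} - X. finite Y \<and> card Y = n \<and> (\<forall>y\<in>Y. \<phi>' y = 0)"
  using assms(4-)
proof (induction n arbitrary: X)
  case 0
  show ?case by (rule exI[of _ "{}"]) auto
next
  case (Suc n)
  define M where "M = Max X"
  define X' where "X' = X - {M}"
  have "X \<noteq> {}" using Suc.prems by auto
  then have M: "M \<in> X" "\<And>x. x \<in> X \<Longrightarrow> x \<le> M"
    using Suc.prems by (auto simp: M_def)
  have X': "finite X'" "card X' = Suc n" "X' \<subseteq> I" "\<And>x. x \<in> X' \<Longrightarrow> \<phi> x = 0"
    using Suc.prems M by (auto simp: X'_def)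
  obtain Y where Y: "Y \<subseteq> interior I \<inter> {..<Max X'} - X'" "finite Y" "card Y = n" "\<forall>y\<in>Y. \<phi>' y = 0"
    using Suc.IH[OF X'] by blast
  define L where "L = Max X'"
  have "X' \<noteq> {}" using X' by auto
  then have L: "L \<in> X'" "\<And>x. x \<in> X' \<Longrightarrow> x \<le> L"
    using X' by (auto simp: L_def)
  have "L < M" using L M by (force simp: X'_def)
  have sub: "{L..M} \<subseteq> I"
    using assms(1) L M X' Suc.prems
    by (metis closed_segment_eq_real_ivl closed_segment_subset \<open>L < M\<close> less_imp_le subsetD)
  have int: "t \<in> interior I" if "L < t" "t < M" for t
  proof (rule interiorI[of "{L<..<M}"])
    show "{L<..<M} \<subseteq> I" using sub by auto
  qed (use that in auto)
  have "\<exists>z>L. z < M \<and> \<phi>' z = 0"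
  proof -
    obtain z where z: "L < z" "z < M" "(\<phi> has_real_derivative 0) (at z)"
    proof (rule Rolle[OF \<open>L < M\<close>, of \<phi>, THEN exE])
      show "\<phi> L = \<phi> M" using L M X' Suc.prems by simp
      show "continuous_on {L..M} \<phi>" using assms(2) sub by (rule continuous_on_subset)
      show "\<phi> differentiable at x" if "L < x" "x < M" for x
        using assms(3)[OF int[OF that]] real_differentiable_def by blast
    qed blast
    then show ?thesis using assms(3)[OF int[OF z(1,2)]] DERIV_unique by blast
  qed
  then obtain z where z: "L < z" "z < M" "\<phi>' z = 0" by blast
  show ?case
  proof (intro exI[of _ "insert z Y"] conjI)
    have "z \<notin> Y" using Y(1) z by (auto simp: L_def)
    then show "card (insert z Y) = Suc n" using Y by simp
    have "z \<notin> X" using L(2)[of z] z by (auto simp: X'_def)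
    moreover have "X = insert M X'" using M by (auto simp: X'_def)
    ultimately show "insert z Y \<subseteq> interior I \<inter> {..<Max X} - X"
      unfolding M_def[symmetric]
      using Y(1) int[OF z(1,2)] z \<open>L < M\<close> unfolding L_def[symmetric] by auto
  qed (use Y z in auto)
qed

text \<open>Each differentiation costs one zero. \<open>D\<close> is an arbitrary chain of
  derivatives, so that the count can start at the first derivative of a function.\<close>

lemma iterated_rolle_zeros:
  fixes D :: "nat \<Rightarrow> real \<Rightarrow> real"
  assumes "convex J" "open J"
    and "\<And>i t. i < j \<Longrightarrow> t \<in> J \<Longrightarrow> (D i has_real_derivative D (Suc i) t) (at t)"
    and "finite X" "card X = n + j" "X \<subseteq> J" "\<And>x. x \<in> X \<Longrightarrow> D 0 x = 0"
  shows "\<exists>Y \<subseteq> J. finite Y \<and> card Y = n \<and> (\<forall>y\<in>Y. D j y = 0)"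
  using assms(3-)
proof (induction j arbitrary: n)
  case 0
  then show ?case by auto
next
  case (Suc j)
  obtain Y where Y: "Y \<subseteq> J" "finite Y" "card Y = Suc n" "\<forall>y\<in>Y. D j y = 0"
    using Suc.IH[of "Suc n"] Suc.prems by auto
  have "continuous_on J (D j)"
    using Suc.prems(1)[of j] by (intro DERIV_atLeastAtMost_imp_continuous_on continuous_at_imp_continuous_on ballI) 
      (auto intro: DERIV_isCont)
  then show ?case
    using rolle_zeros[of J "D j" "D (Suc j)" Y n] Y Suc.prems(1)[of j] assms(1,2)
    by (auto simp: interior_open)
qed

text \<open>The deviation of a quadratic from its chord is governed by the coefficient of order 2
  alone. If a concave function meets the quadratic in three points, this gives the sign of that
  coefficient.\<close>

lemma poly_quadratic_affine_combination:
  fixes q :: "real poly" and u v :: real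
  assumes "degree q \<le> 2" "u + v = 1"
  shows "poly q (u * x + v * y) = u * poly q x + v * poly q y - coeff q 2 * (u * v * (x - y)\<^sup>2)"
proof -
  have "poly q t = coeff q 0 + coeff q 1 * t + coeff q 2 * t\<^sup>2" for t
    using assms(1) by (subst poly_as_sum_of_monoms'[OF assms(1), symmetric]) (simp add: poly_sum poly_monom numeral_2_eq_2)
  then have *: "poly q = (\<lambda>t. coeff q 0 + coeff q 1 * t + coeff q 2 * t\<^sup>2)" by auto
  have v: "v = 1 - u" using assms(2) by simp
  show ?thesis unfolding * v by (simp add: algebra_simps power2_eq_square)
qed

text \<open>The coefficient is the divided difference of \<open>g\<close> over \<open>s\<close>,
  \<open>e\<close> and the points of \<open>B\<close> taken twice. For smoother \<open>g\<close> it
  would be a value of the derivative of order 2m+1 divided by (2m+1)!; concavity of the derivative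
  of order 2m-1 replaces nonpositivity of that derivative.\<close>

lemma hermite_remainder_coeff:
  fixes g :: "real \<Rightarrow> real" and p :: "real poly"
  assumes "convex I" "continuous_on I g"
    and diff: "\<And>k t. k < 2 * m - 1 \<Longrightarrow> t \<in> interior I \<Longrightarrow> (deriv ^^ k) g differentiable (at t)"
    and B: "finite B" "card B = m" "m \<ge> 1" "B \<subseteq> interior I"
    and se: "s \<in> I" "e \<in> I" "s \<noteq> e" "s \<notin> B" "e \<notin> B"
    and p: "degree p \<le> 2 * m + 1" "\<And>x. x \<in> insert s (insert e B) \<Longrightarrow> poly p x = g x"
      "\<And>x. x \<in> B \<Longrightarrow> poly (pderiv p) x = deriv g x"
    and conc: "concave_on (interior I) ((deriv ^^ (2 * m - 1)) g)"
  shows "coeff p (2 * m + 1) \<le> 0"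
    and "strictly_concave_on (interior I) ((deriv ^^ (2 * m - 1)) g) \<Longrightarrow> coeff p (2 * m + 1) < 0"
proof -
  define J where "J = interior I"
  have J: "convex J" "open J" using assms(1) by (auto simp: J_def convex_interior)
  define D where "D k t = (deriv ^^ k) g t - poly ((pderiv ^^ k) p) t" for k t
  have D: "(D k has_real_derivative D (Suc k) t) (at t)" if "k < 2 * m - 1" "t \<in> J" for k t
  proof -
    have "((deriv ^^ k) g has_real_derivative (deriv ^^ Suc k) g t) (at t)"
      using diff[of k t] that by (simp add: J_def DERIV_deriv_iff_real_differentiable)
    moreover have "(poly ((pderiv ^^ k) p) has_real_derivative poly ((pderiv ^^ Suc k) p) t) (at t)"
      using poly_DERIV[of "(pderiv ^^ k) p" t] by simp
    ultimately show ?thesis unfolding D_def[abs_def] by (rule DERIV_diff)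
  qed
  have contD: "continuous_on I (D 0)"
    unfolding D_def[abs_def] using assms(2) by (auto intro!: continuous_intros)
  have "B \<subseteq> I" using B interior_subset by blast
  then have XI: "insert s (insert e B) \<subseteq> I" using se by auto
  have cX: "card (insert s (insert e B)) = Suc (Suc m)" using B se by simp
  have zX: "D 0 x = 0" if "x \<in> insert s (insert e B)" for x
    using p(2)[OF that] by (simp add: D_def)
  have D0: "(D 0 has_real_derivative D 1 t) (at t)" if "t \<in> interior I" for t
    using D[of 0 t] that B(3) by (simp add: J_def)
  have "finite (insert s (insert e B))" using B by simp
  from rolle_zeros[OF assms(1) contD D0 this cX XI zX]
  obtain Y where Y: "Y \<subseteq> J - insert s (insert e B)" "finite Y" "card Y = Suc m" "\<And>y. y \<in> Y \<Longrightarrow> D 1 y = 0"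
    unfolding J_def by blast
  \<comment> \<open>The first derivative of \<open>g - p\<close> vanishes at \<open>m + 1\<close> points from Rolle's theorem and at the \<open>m\<close>
    double nodes, so its derivative of order \<open>2m - 1\<close> has three zeros: a quadratic polynomial meets
    a concave function in three points.\<close>
  define X where "X = Y \<union> B"
  have "card X = card Y + card B"
    unfolding X_def using Y B by (intro card_Un_disjoint) auto
  then have X: "finite X" "card X = 3 + (2 * m - 2)" "X \<subseteq> J"
    using Y(1-3) B by (auto simp: X_def J_def)
  have DX: "D 1 x = 0" if "x \<in> X" for x
    using that Y(4) p(3)[of x] by (auto simp: X_def D_def)
  obtain Z where Z: "Z \<subseteq> J" "finite Z" "card Z = 3" "\<forall>z\<in>Z. D (Suc (2 * m - 2)) z = 0"
  proof -
    have "(D (Suc i) has_real_derivative D (Suc (Suc i)) t) (at t)" if "i < 2 * m - 2" "t \<in> J" for i t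
      using that by (intro D) auto
    from iterated_rolle_zeros[of J "2 * m - 2" "\<lambda>i. D (Suc i)", OF J this X]
    show ?thesis using DX that by auto
  qed
  have Sm: "Suc (2 * m - 2) = 2 * m - 1" using B(3) by simp
  define a c where "a = Min Z" and "c = Max Z"
  have "Z \<noteq> {}" using Z by auto
  then have ac: "a \<in> Z" "c \<in> Z" "\<And>z. z \<in> Z \<Longrightarrow> a \<le> z \<and> z \<le> c" using Z by (auto simp: a_def c_def)
  have "card (Z - {a, c}) \<ge> 1"
    using Z ac card_Diff_subset[of "{a,c}" Z] card_insert_le_m1[of 2 "{c}" a] by auto
  then obtain b where b: "b \<in> Z" "b \<noteq> a" "b \<noteq> c"
    by (metis Diff_iff card.empty ex_in_conv insertI1 insertI2 not_one_le_zero)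
  have abc: "a < b" "b < c" using ac(3)[OF b(1)] b by auto
  \<comment> \<open>Barycentric weights of the middle zero \<open>b\<close> with respect to
    \<open>a\<close> and \<open>c\<close>.\<close>
  define u v where "u = (c - b) / (c - a)" and "v = (b - a) / (c - a)"
  have uv: "u > 0" "v > 0" "u + v = 1"
    using abc by (auto simp: u_def v_def simp flip: add_divide_distrib)
  have "u * a + v * c = ((c - b) * a + (b - a) * c) / (c - a)"
    by (simp add: u_def v_def add_divide_distrib)
  also have "(c - b) * a + (b - a) * c = b * (c - a)"
    by (simp add: algebra_simps)
  finally have ub: "u * a + v * c = b" using abc by simp
  define q where "q = (pderiv ^^ (2 * m - 1)) p"
  define G where "G = (deriv ^^ (2 * m - 1)) g"
  have Gq: "G z = poly q z" if "z \<in> Z" for z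
    using Z(4) that by (auto simp: D_def q_def G_def Sm)
  have "degree q \<le> 2" using p(1) B(3) by (simp add: q_def degree_higher_pderiv)
  then have "poly q b = u * poly q a + v * poly q c - coeff q 2 * (u * v * (a - c)\<^sup>2)"
    using poly_quadratic_affine_combination[of q u v a c] uv ub by simp
  then have eq: "coeff q 2 * (u * v * (a - c)\<^sup>2) = u * G a + v * G c - G b"
    using Gq ac b by simp
  have pos: "u * v * (a - c)\<^sup>2 > 0" using uv abc by simp
  \<comment> \<open>Differentiating 2m-1 times multiplies the coefficient of order 2m+1 by 3 * 4 *
    ... * (2m+1), which is positive, so both coefficients have the same sign.\<close>
  have cq: "coeff q 2 = pochhammer 3 (2 * m - 1) * coeff p (2 * m + 1)"
  proof -
    have "2 + (2 * m - 1) = 2 * m + 1" using B(3) by simp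
    then show ?thesis unfolding q_def coeff_higher_pderiv by (simp add: numeral_3_eq_3)
  qed
  have poch: "pochhammer 3 (2 * m - 1) > (0 :: real)" by (rule pochhammer_pos) simp
  have "u * G a + v * G c \<le> G b"
    using conc subsetD[OF Z(1) ac(1)] subsetD[OF Z(1) ac(2)] uv ub
    unfolding concave_on_iff G_def J_def[symmetric] by fastforce
  then have "coeff q 2 * (u * v * (a - c)\<^sup>2) \<le> 0" using eq by simp
  then show "coeff p (2 * m + 1) \<le> 0"
    using pos poch unfolding cq mult.commute[of _ "u * v * (a - c)\<^sup>2"] by (metis mult_pos_pos not_le)
  assume "strictly_concave_on (interior I) ((deriv ^^ (2 * m - 1)) g)"
  then have "u * G a + v * G c < G (u *\<^sub>R a + v *\<^sub>R c)"
    using subsetD[OF Z(1) ac(1)] subsetD[OF Z(1) ac(2)] uv abc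
    unfolding strictly_concave_on_def G_def J_def[symmetric] by simp
  then have "coeff q 2 * (u * v * (a - c)\<^sup>2) < 0" using eq ub by simp
  then show "coeff p (2 * m + 1) < 0"
    using pos poch unfolding cq mult.commute[of _ "u * v * (a - c)\<^sup>2"] by (metis mult_nonneg_nonneg less_imp_le not_le)
qed

section \<open>Existence of Hermite interpolants\<close>

text \<open>Newton's scheme: \<open>W\<close> has double zeros at the old nodes, so adding
  \<open>W\<close> times a linear polynomial keeps the old data, and its two coefficients match
  value and derivative at the new node. Without nodes the degree bound is 0 by truncated
  subtraction, which the zero polynomial meets.\<close>

lemma hermite_interpolation_double:
  fixes v w :: "'a::{field_char_0} \<Rightarrow> 'a"
  assumes "finite B"
  shows "\<exists>p. degree p \<le> 2 * card B - 1 \<and> (\<forall>x\<in>B. poly p x = v x \<and> poly (pderiv p) x = w x)"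
  using assms
proof (induction B)
  case empty
  show ?case by (rule exI[of _ 0]) auto
next
  case (insert b B)
  then obtain p where p: "degree p \<le> 2 * card B - 1"
    "\<forall>x\<in>B. poly p x = v x \<and> poly (pderiv p) x = w x" by blast
  define W where "W = (\<Prod>x\<in>B. [:-x, 1:])\<^sup>2"
  have Wb: "poly W b \<noteq> 0" using insert.hyps by (auto simp: W_def poly_prod)
  have W0: "poly W x = 0" "poly (pderiv W) x = 0" if "x \<in> B" for x
    using that insert.hyps by (auto simp: W_def poly_prod pderiv_mult power2_eq_square)
  have dW: "degree W = 2 * card B"
    unfolding W_def by (subst degree_power_eq) (auto simp: degree_prod_sum_eq insert.hyps)
  define c where "c = (v b - poly p b) / poly W b"
  define d where "d = (w b - poly (pderiv p) b - c * poly (pderiv W) b) / poly W b"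
  define r where "r = p + W * [:c - d * b, d:]"
  have r: "poly r x = poly p x + poly W x * (c + d * (x - b))"
    "poly (pderiv r) x = poly (pderiv p) x + poly (pderiv W) x * (c + d * (x - b)) + poly W x * d" for x
    by (simp_all add: r_def pderiv_mult pderiv_add pderiv_pCons pderiv_smult algebra_simps)
  have cb: "poly W b * c = v b - poly p b" "poly W b * d = w b - poly (pderiv p) b - c * poly (pderiv W) b"
    using Wb by (simp_all add: c_def d_def)
  have "poly r x = v x \<and> poly (pderiv r) x = w x" if "x \<in> insert b B" for x
    using that p W0 cb by (auto simp: r)
  moreover have "degree (W * [:c - d * b, d:]) \<le> 2 * card B + 1"
    using degree_mult_le[of W "[:c - d * b, d:]"] dW by (simp split: if_splits)
  then have "degree r \<le> 2 * card (insert b B) - 1"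
    unfolding r_def using insert.hyps p(1) by (intro degree_add_le) auto
  ultimately show ?case by blast
qed

text \<open>One more Newton step: a multiple of \<open>W\<close> corrects the value at
  \<open>e\<close> without disturbing the double nodes.\<close>

lemma hermite_interpolation_double_simple:
  fixes v w :: "'a::{field_char_0} \<Rightarrow> 'a"
  assumes "finite B" "e \<notin> B" "card B \<ge> 1"
  shows "\<exists>p. degree p \<le> 2 * card B \<and> (\<forall>x\<in>insert e B. poly p x = v x) \<and> (\<forall>x\<in>B. poly (pderiv p) x = w x)"
proof -
  obtain p where p: "degree p \<le> 2 * card B - 1" "\<forall>x\<in>B. poly p x = v x \<and> poly (pderiv p) x = w x"
    using hermite_interpolation_double[OF assms(1)] by blast
  define W where "W = (\<Prod>x\<in>B. [:-x, 1:])\<^sup>2"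
  have We: "poly W e \<noteq> 0" using assms by (auto simp: W_def poly_prod)
  have W0: "poly W x = 0" "poly (pderiv W) x = 0" if "x \<in> B" for x
    using that assms by (auto simp: W_def poly_prod pderiv_mult power2_eq_square)
  have dW: "degree W = 2 * card B"
    unfolding W_def by (subst degree_power_eq) (auto simp: degree_prod_sum_eq assms)
  define c where "c = (v e - poly p e) / poly W e"
  define r where "r = p + smult c W"
  have "degree r \<le> 2 * card B"
    unfolding r_def using p(1) dW degree_smult_le[of c W] by (intro degree_add_le) auto
  moreover have "poly r e = v e" using We by (simp add: r_def c_def)
  moreover have "poly r x = v x" "poly (pderiv r) x = w x" if "x \<in> B" for x
    using that p W0 by (simp_all add: r_def pderiv_add pderiv_smult)
  ultimately show ?thesis by (intro exI[of _ r]) auto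
qed

section \<open>The interpolant as a lower bound\<close>

text \<open>Newton's form of the error: \<open>c\<close> is chosen so that
  \<open>p + smult c W\<close> also interpolates at \<open>s\<close>, hence the error at
  \<open>s\<close> is \<open>c * poly W s\<close>. For \<open>s < e\<close> outside \<open>B\<close>
  the square factor makes \<open>poly W s\<close> negative, and \<open>c\<close> has the sign found
  in \<open>hermite_remainder_coeff\<close>.\<close>

lemma hermite_lower_bound:
  fixes g :: "real \<Rightarrow> real" and p :: "real poly"
  assumes I: "convex I" "continuous_on I g"
    and diff: "\<And>k t. k < 2 * m - 1 \<Longrightarrow> t \<in> interior I \<Longrightarrow> (deriv ^^ k) g differentiable (at t)"
    and B: "finite B" "card B = m" "m \<ge> 1" "B \<subseteq> interior I"
    and e: "e \<in> I" "e \<notin> B"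
    and p: "degree p \<le> 2 * m" "\<And>x. x \<in> insert e B \<Longrightarrow> poly p x = g x"
      "\<And>x. x \<in> B \<Longrightarrow> poly (pderiv p) x = deriv g x"
    and conc: "concave_on (interior I) ((deriv ^^ (2 * m - 1)) g)"
    and s: "s \<in> I" "s < e"
  shows "poly p s \<le> g s"
    and "strictly_concave_on (interior I) ((deriv ^^ (2 * m - 1)) g) \<Longrightarrow> s \<notin> B \<Longrightarrow> poly p s < g s"
proof -
  define V where "V = (\<Prod>x\<in>B. [:-x, 1:])\<^sup>2"
  define W where "W = [:-e, 1:] * V"
  have Vnz: "V \<noteq> 0" using B by (auto simp: V_def)
  have V0: "poly V x = 0" "poly (pderiv V) x = 0" if "x \<in> B" for x
    using that B by (auto simp: V_def poly_prod pderiv_mult power2_eq_square)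
  have W0: "poly W x = 0" if "x \<in> insert e B" for x
    using that V0 by (auto simp: W_def)
  have W0': "poly (pderiv W) x = 0" if "x \<in> B" for x
    using that V0 unfolding W_def pderiv_mult by simp
  have "degree V = 2 * m"
    unfolding V_def by (subst degree_power_eq) (auto simp: degree_prod_sum_eq B)
  then have dW: "degree W = 2 * m + 1"
    unfolding W_def using Vnz by (subst degree_mult_eq) auto
  have "lead_coeff V = 1"
    by (simp add: V_def lead_coeff_power lead_coeff_prod)
  then have "lead_coeff W = 1"
    unfolding W_def lead_coeff_mult by simp
  then have cW: "coeff W (2 * m + 1) = 1" by (simp only: dW)
  define c where "c = (g s - poly p s) / poly W s"
  define q where "q = p + smult c W"
  have cq: "coeff q (2 * m + 1) = c"
    using p(1) cW by (simp add: q_def coeff_eq_0)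
  have main: "poly p s \<le> g s \<and> 
      (strictly_concave_on (interior I) ((deriv ^^ (2 * m - 1)) g) \<longrightarrow> poly p s < g s)" if sB: "s \<notin> B"
  proof -
    have "poly V s > 0" using sB B(1) by (auto simp: V_def poly_prod zero_less_power2)
    then have Ws: "poly W s < 0" using s by (simp add: W_def mult_neg_pos)
    then have cWs: "g s = poly p s + c * poly W s" by (simp add: c_def)
    have "poly q x = g x" if "x \<in> insert s (insert e B)" for x
      using that p(2) W0 cWs by (auto simp: q_def)
    moreover have "poly (pderiv q) x = deriv g x" if "x \<in> B" for x
      using that p(3) W0' by (simp add: q_def pderiv_add pderiv_smult)
    moreover have "degree q \<le> 2 * m + 1"
      unfolding q_def using p(1) dW degree_smult_le[of c W] by (intro degree_add_le) auto
    moreover have "s \<noteq> e" using s by simp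
    ultimately have "c \<le> 0" "strictly_concave_on (interior I) ((deriv ^^ (2 * m - 1)) g) \<Longrightarrow> c < 0"
      using hermite_remainder_coeff[OF I diff B s(1) e(1) _ sB e(2) _ _ _ conc, of q] cq by auto
    then show ?thesis using cWs Ws by (auto simp: mult_nonpos_nonpos mult_neg_neg less_imp_le)
  qed
  \<comment> \<open>For \<open>s\<close> in \<open>B\<close> the quotient defining \<open>c\<close>
    has denominator 0 and says nothing; there the interpolation condition gives equality.\<close>
  show "poly p s \<le> g s" using main p(2)[of s] by (cases "s \<in> B") auto
  show "poly p s < g s" if "strictly_concave_on (interior I) ((deriv ^^ (2 * m - 1)) g)" "s \<notin> B"
    using main that by blast
qed

section \<open>Zonal polynomials on the sphere\<close>

definition monomial_fun :: "('n \<Rightarrow> nat) \<Rightarrow> real ^ 'n \<Rightarrow> real" where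
  "monomial_fun \<alpha> x = (\<Prod>i\<in>UNIV. (x $ i) ^ \<alpha> i)"

definition multi_indices :: "nat \<Rightarrow> ('n::finite \<Rightarrow> nat) set" where
  "multi_indices n = {\<alpha>. sum \<alpha> UNIV \<le> n}"

lemma finite_multi_indices_set [simp]: "finite (multi_indices n)"
  unfolding multi_indices_def by (rule finite_multi_indices)

lemma poly_fun_le_iff:
  "poly_fun_le n q \<longleftrightarrow> (\<exists>c. \<forall>x. q x = (\<Sum>\<alpha>\<in>multi_indices n. c \<alpha> * monomial_fun \<alpha> x))"
  by (simp add: poly_fun_le_def multi_indices_def monomial_fun_def fun_eq_iff)

lemma poly_fun_le_mono:
  assumes "poly_fun_le n q" "n \<le> k"
  shows "poly_fun_le k q"
proof -
  obtain c where q: "\<And>x. q x = (\<Sum>\<alpha>\<in>multi_indices n. c \<alpha> * monomial_fun \<alpha> x)"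
    using assms(1) unfolding poly_fun_le_iff by blast
  have "q x = (\<Sum>\<alpha>\<in>multi_indices k. (if \<alpha> \<in> multi_indices n then c \<alpha> else 0) * monomial_fun \<alpha> x)" for x
    unfolding q using assms(2)
    by (intro sum.mono_neutral_cong_left) (auto simp: multi_indices_def[of k] multi_indices_def[of n] finite_multi_indices)
  then show ?thesis
    unfolding poly_fun_le_iff by (intro exI[of _ "\<lambda>\<alpha>. if \<alpha> \<in> multi_indices n then c \<alpha> else 0"]) simp
qed

lemma poly_fun_le_add:
  assumes "poly_fun_le n p" "poly_fun_le n q"
  shows "poly_fun_le n (\<lambda>x. p x + q x)"
proof -
  obtain c d where "\<And>x. p x = (\<Sum>\<alpha>\<in>multi_indices n. c \<alpha> * monomial_fun \<alpha> x)"
    "\<And>x. q x = (\<Sum>\<alpha>\<in>multi_indices n. d \<alpha> * monomial_fun \<alpha> x)"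
    using assms unfolding poly_fun_le_iff by blast
  then show ?thesis
    unfolding poly_fun_le_iff
    by (intro exI[of _ "\<lambda>\<alpha>. c \<alpha> + d \<alpha>"]) (simp add: sum.distrib distrib_right)
qed

lemma poly_fun_le_cmult:
  assumes "poly_fun_le n p"
  shows "poly_fun_le n (\<lambda>x. a * p x)"
proof -
  obtain c where "\<And>x. p x = (\<Sum>\<alpha>\<in>multi_indices n. c \<alpha> * monomial_fun \<alpha> x)"
    using assms unfolding poly_fun_le_iff by blast
  then show ?thesis
    unfolding poly_fun_le_iff
    by (intro exI[of _ "\<lambda>\<alpha>. a * c \<alpha>"]) (simp add: sum_distrib_left mult.assoc)
qed

lemma poly_fun_le_const: "poly_fun_le n (\<lambda>x :: real ^ 'n. a)"
proof -
  have "multi_indices 0 = {\<lambda>_ :: 'n. 0}" by (auto simp: multi_indices_def)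
  then have "poly_fun_le 0 (\<lambda>x :: real ^ 'n. a)"
    unfolding poly_fun_le_iff by (intro exI[of _ "\<lambda>_. a"]) (simp add: monomial_fun_def)
  then show ?thesis by (rule poly_fun_le_mono) simp
qed

lemma poly_fun_le_sum:
  "(\<And>i. i \<in> I \<Longrightarrow> poly_fun_le n (p i)) \<Longrightarrow> poly_fun_le n (\<lambda>x. \<Sum>i\<in>I. p i x)"
  by (induction I rule: infinite_finite_induct) (auto intro: poly_fun_le_const poly_fun_le_add)

text \<open>Multiplication by a coordinate raises one exponent: \<open>up\<close> maps the
  multi-indices of sum at most n bijectively onto those of sum at most n+1 that are positive at
  \<open>j\<close>, with inverse \<open>dn\<close>. The others do not occur in the product, so
  \<open>c'\<close> is 0 there.\<close>

lemma poly_fun_le_coord: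
  fixes q :: "real ^ 'n \<Rightarrow> real"
  assumes "poly_fun_le n q"
  shows "poly_fun_le (Suc n) (\<lambda>x. x $ j * q x)"
proof -
  obtain c where q: "\<And>x. q x = (\<Sum>\<alpha>\<in>multi_indices n. c \<alpha> * monomial_fun \<alpha> x)"
    using assms unfolding poly_fun_le_iff by blast
  define up where "up \<alpha> = \<alpha>(j := Suc (\<alpha> j))" for \<alpha> :: "'n \<Rightarrow> nat"
  define dn where "dn \<alpha> = \<alpha>(j := \<alpha> j - 1)" for \<alpha> :: "'n \<Rightarrow> nat"
  have dnup: "dn (up \<alpha>) = \<alpha>" for \<alpha> by (auto simp: dn_def up_def)
  have updn: "up (dn \<alpha>) = \<alpha>" if "\<alpha> j \<noteq> 0" for \<alpha> using that by (auto simp: dn_def up_def)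
  have upj: "up \<alpha> j = Suc (\<alpha> j)" for \<alpha> by (simp add: up_def)
  have sum_up: "sum (up \<alpha>) UNIV = Suc (sum \<alpha> UNIV)" for \<alpha>
    by (simp add: up_def sum.remove[of UNIV j])
  have mon_up: "monomial_fun (up \<alpha>) x = x $ j * monomial_fun \<alpha> x" for x \<alpha>
    by (simp add: monomial_fun_def up_def prod.remove[of UNIV j])
  define c' where "c' \<alpha> = (if \<alpha> j = 0 then 0 else c (dn \<alpha>))" for \<alpha>
  have "x $ j * q x = (\<Sum>\<alpha>\<in>multi_indices (Suc n). c' \<alpha> * monomial_fun \<alpha> x)" for x
  proof -
    have "x $ j * q x = (\<Sum>\<alpha>\<in>multi_indices n. c \<alpha> * monomial_fun (up \<alpha>) x)"
      by (simp add: q sum_distrib_left mon_up mult.left_commute)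
    also have "\<dots> = (\<Sum>\<alpha>\<in>{\<alpha> \<in> multi_indices (Suc n). \<alpha> j \<noteq> 0}. c' \<alpha> * monomial_fun \<alpha> x)"
    proof (rule sum.reindex_bij_witness[where i = dn and j = up])
      fix \<alpha> assume "\<alpha> \<in> {\<alpha> \<in> multi_indices (Suc n). \<alpha> j \<noteq> 0}"
      then show "dn \<alpha> \<in> multi_indices n"
        using sum_up[of "dn \<alpha>"] updn[of \<alpha>] by (simp add: multi_indices_def)
    qed (auto simp: dnup updn sum_up upj multi_indices_def c'_def)
    also have "\<dots> = (\<Sum>\<alpha>\<in>multi_indices (Suc n). c' \<alpha> * monomial_fun \<alpha> x)"
      by (rule sum.mono_neutral_left) (auto simp: c'_def)
    finally show ?thesis .
  qed
  then show ?thesis unfolding poly_fun_le_iff by blast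
qed

text \<open>Horner's scheme, with the dot product written out in coordinates: each step multiplies
  by coordinates once and adds a constant.\<close>

lemma poly_fun_le_poly_inner:
  fixes z :: "real ^ 'n"
  shows "poly_fun_le (degree p) (\<lambda>x. poly p (z \<bullet> x))"
proof (induction p)
  case 0
  show ?case by (simp add: poly_fun_le_const)
next
  case (pCons a p)
  have eq: "(\<lambda>x. poly (pCons a p) (z \<bullet> x)) =
      (\<lambda>x. a + (\<Sum>j\<in>UNIV. z $ j * (x $ j * poly p (z \<bullet> x))))"
    by (auto simp: inner_vec_def sum_distrib_right mult.assoc)
  \<comment> \<open>The degree of \<open>pCons a p\<close> exceeds that of \<open>p\<close> only for
    nonzero \<open>p\<close>.\<close>
  show ?case
  proof (cases "p = 0")
    case True
    then show ?thesis by (simp add: poly_fun_le_const)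
  next
    case False
    then show ?thesis unfolding eq using pCons.IH
      by (simp add: poly_fun_le_add poly_fun_le_const poly_fun_le_sum poly_fun_le_cmult poly_fun_le_coord)
  qed
qed

section \<open>Integration over the sphere\<close>

lemma finite_measure_sphere_measure: "finite_measure (sphere_measure :: (real ^ 'n) measure)"
  by (rule finite_measureI) (simp add: space_sphere_measure emeasure_sphere_measure_sphere)

lemma measurable_sphere_measure_continuous:
  fixes q :: "real ^ 'n \<Rightarrow> real"
  assumes "continuous_on UNIV q"
  shows "q \<in> borel_measurable sphere_measure"
proof -
  have "q \<in> borel_measurable (restrict_space borel (sphere 0 1))"
    using assms by (intro measurable_restrict_space1 borel_measurable_continuous_onI)
  then show ?thesis using measurable_cong_sets[OF sets_sphere_measure refl] by blast
qed

text \<open>An orthogonal map \<open>T\<close> with \<open>T z = w\<close> preserves the measure,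
  and the dot product of \<open>w\<close> with \<open>T x\<close> is that of \<open>z\<close> with
  \<open>x\<close>.\<close>

lemma integral_sphere_measure_inner:
  fixes z w :: "real ^ 'n"
  assumes "norm z = 1" "norm w = 1" and h: "continuous_on UNIV h"
  shows "(\<integral>x. h (z \<bullet> x) \<partial>sphere_measure) = (\<integral>x. (h (w \<bullet> x) :: real) \<partial>sphere_measure)"
proof -
  let ?S = "sphere_measure :: (real ^ 'n) measure"
  obtain T where T: "orthogonal_transformation T" "T z = w"
    using orthogonal_transformation_exists[of z w] assms by metis
  have "linear T" using T(1) by (rule orthogonal_transformation_linear)
  then have "T \<in> borel_measurable borel"
    by (intro borel_measurable_continuous_onI linear_continuous_on)
       (simp add: linear_conv_bounded_linear)
  then have "T \<in> restrict_space borel (sphere 0 1) \<rightarrow>\<^sub>M restrict_space borel (sphere 0 1)"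
    using orthogonal_transformation_norm[OF T(1)]
    by (intro measurable_restrict_space3) auto
  then have TM [measurable]: "T \<in> ?S \<rightarrow>\<^sub>M ?S"
    using measurable_cong_sets[OF sets_sphere_measure sets_sphere_measure] by blast
  have "distr ?S ?S T = ?S"
  proof (rule measure_eqI)
    fix A assume "A \<in> sets (distr ?S ?S T)"
    then have A: "A \<in> sets ?S" by simp
    then have A': "A \<in> sets borel" "A \<subseteq> sphere 0 1"
      by (auto simp: sets_sphere_measure sets_restrict_space_iff)
    have "T -` A \<inter> sphere 0 1 = T -` A"
      using A'(2) orthogonal_transformation_norm[OF T(1)] by (auto simp: subset_iff)
    then show "emeasure (distr ?S ?S T) A = emeasure ?S A"
      using sphere_measure_rotation_invariant[OF T(1) A'] A
      by (simp add: emeasure_distr space_sphere_measure)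
  qed simp
  then have "(\<integral>x. h (w \<bullet> x) \<partial>?S) = (\<integral>x. h (w \<bullet> x) \<partial>distr ?S ?S T)" by simp
  also have "\<dots> = (\<integral>x. h (w \<bullet> T x) \<partial>?S)"
    by (intro integral_distr TM measurable_sphere_measure_continuous continuous_on_compose2[OF h])
       (auto intro!: continuous_intros)
  also have "\<dots> = (\<integral>x. h (z \<bullet> x) \<partial>?S)"
    using T unfolding orthogonal_transformation_def by metis
  finally show ?thesis ..
qed

text \<open>The surface measure charges every nonempty open part of the sphere: if \<open>q\<close>
  did not vanish at \<open>z\<close>, the cone over its nonvanishing set would be a nonempty open
  null set.\<close>

lemma integral_sphere_measure_zero_imp_zero:
  fixes q :: "real ^ 'n \<Rightarrow> real"
  assumes q: "continuous_on UNIV q" "\<And>x. norm x = 1 \<Longrightarrow> q x \<ge> 0"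
    and int: "(\<integral>x. q x \<partial>sphere_measure) = 0" and z: "norm z = 1"
  shows "q z = 0"
proof (rule ccontr)
  assume nz: "q z \<noteq> 0"
  let ?S = "sphere_measure :: (real ^ 'n) measure"
  interpret finite_measure ?S by (rule finite_measure_sphere_measure)
  have qm [measurable]: "q \<in> borel_measurable ?S" by (rule measurable_sphere_measure_continuous[OF q(1)])
  have "continuous_on (sphere 0 1) q"
    using q(1) by (rule continuous_on_subset) simp
  then have "bounded (q ` sphere 0 1)"
    by (intro compact_imp_bounded compact_continuous_image compact_sphere)
  then obtain K where K: "\<And>x. x \<in> sphere 0 1 \<Longrightarrow> norm (q x) \<le> K"
    unfolding bounded_iff by blast
  have "integrable ?S q"
    using K by (intro integrable_const_bound[of _ K]) (auto simp: space_sphere_measure)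
  then have "AE x in ?S. q x = 0"
    using int q(2) by (subst (asm) integral_nonneg_eq_0_iff_AE) (auto simp: space_sphere_measure)
  then have "emeasure ?S {x \<in> space ?S. q x \<noteq> 0} = 0"
    by (subst (asm) AE_iff_measurable[OF _ refl]) auto
  moreover have "{x \<in> space ?S. q x \<noteq> 0} = {x \<in> sphere 0 1. q x \<noteq> 0}"
    by (simp add: space_sphere_measure)
  moreover have m: "{x \<in> sphere 0 1. q x \<noteq> 0} \<in> sets borel"
  proof -
    have "open {x. q x \<noteq> 0}"
      by (intro open_Collect_neq q(1) continuous_on_const)
    moreover have "{x \<in> sphere 0 1. q x \<noteq> 0} = sphere 0 1 \<inter> {x. q x \<noteq> 0}" by auto
    ultimately show ?thesis by auto
  qed
  \<comment> \<open>The apex 0 is left out because \<open>sgn\<close> is discontinuous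
    there.\<close>
  define U where "U = {x \<in> ball 0 1 - {0}. q (sgn x) \<noteq> 0}"
  have "open U"
  proof -
    have "continuous_on (ball 0 1 - {0} :: (real ^ 'n) set) (\<lambda>x. q (sgn x))"
      unfolding sgn_div_norm by (intro continuous_on_compose2[OF q(1)] continuous_intros) auto
    then have "open ((ball 0 1 - {0}) \<inter> (\<lambda>x. q (sgn x)) -` (- {0}))"
      by (intro continuous_open_preimage) auto
    moreover have "U = (ball 0 1 - {0}) \<inter> (\<lambda>x. q (sgn x)) -` (- {0})"
      by (auto simp: U_def)
    ultimately show ?thesis by simp
  qed
  ultimately have "emeasure lborel {x \<in> ball 0 1. sgn x \<in> {x \<in> sphere 0 1. q x \<noteq> 0}} = 0"
    using emeasure_sphere_measure[OF m Collect_restrict] emeasure_unit_ball_pos_finite[where 'n = 'n]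
    by (simp add: ennreal_divide_eq_0_iff)
  moreover have "{x \<in> ball 0 1. sgn x \<in> {x \<in> sphere 0 1. q x \<noteq> 0}} = U"
    by (auto simp: U_def norm_sgn split: if_splits)
  ultimately have "emeasure lborel U = 0" by simp
  then have "U \<in> null_sets lborel" using \<open>open U\<close> by (intro null_setsI) auto
  then have "negligible U" using negligible_iff_null_sets null_sets_completionI by blast
  then have "U = {}" using \<open>open U\<close> open_not_negligible by blast
  moreover have "(1/2) *\<^sub>R z \<in> U" using z nz by (auto simp: U_def sgn_div_norm)
  ultimately show False by simp
qed

text \<open>The sphere is connected in dimension at least 2, and the dot product with
  \<open>z\<close> is 1 at \<open>z\<close> and -1 at \<open>- z\<close>.\<close>

lemma sphere_inner_surj:
  fixes z :: "real ^ 'n"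
  assumes "CARD('n) \<ge> 2" "norm z = 1" "s \<in> {-1..1}"
  shows "\<exists>x. norm x = 1 \<and> z \<bullet> x = s"
proof -
  have "connected ((\<bullet>) z ` sphere 0 1)"
    using assms(1) by (intro connected_continuous_image connected_sphere continuous_intros) auto
  moreover have "z \<bullet> z = 1" "z \<bullet> (- z) = -1" using assms(2) by (auto simp: dot_square_norm)
  then have "1 \<in> (\<bullet>) z ` sphere 0 1" "-1 \<in> (\<bullet>) z ` sphere 0 1"
    using assms(2) by (metis imageI mem_sphere_0) (metis \<open>z \<bullet> - z = - 1\<close> assms(2) imageI mem_sphere_0 norm_minus_cancel)
  ultimately have "s \<in> (\<bullet>) z ` sphere 0 1"
    using assms(3) connectedD_interval[of _ "-1" 1 s] by auto
  then show ?thesis by auto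
qed

section \<open>Designs tested on polynomials in one dot product\<close>

text \<open>Both averages equal integrals over the sphere, which agree by rotation
  invariance.\<close>

lemma design_sum_poly_inner:
  fixes z w :: "real ^ 'n"
  assumes "spherical_design n \<omega>" "degree p \<le> n" "norm z = 1" "norm w = 1"
  shows "(\<Sum>x\<in>\<omega>. poly p (z \<bullet> x)) = (\<Sum>x\<in>\<omega>. poly p (w \<bullet> x))"
proof -
  have avg: "(1 / real (card \<omega>)) * (\<Sum>x\<in>\<omega>. poly p (v \<bullet> x)) = (\<integral>x. poly p (v \<bullet> x) \<partial>sphere_measure)" for v
    using assms(1) poly_fun_le_mono[OF poly_fun_le_poly_inner assms(2), of v]
    unfolding spherical_design_def by blast
  have "card \<omega> \<noteq> 0" using assms(1) by (auto simp: spherical_design_def)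
  moreover have "continuous_on UNIV (poly p)" by (intro continuous_intros)
  from integral_sphere_measure_inner[OF assms(3,4) this]
  have "(1 / real (card \<omega>)) * (\<Sum>x\<in>\<omega>. poly p (z \<bullet> x)) = (1 / real (card \<omega>)) * (\<Sum>x\<in>\<omega>. poly p (w \<bullet> x))"
    unfolding avg .
  ultimately show ?thesis by simp
qed

text \<open>Otherwise the integral vanishes, so the nonnegative polynomial is 0 at every dot product
  with \<open>z\<close>, that is, on all of [-1,1]. The point \<open>z\<close> may lie outside the
  configuration.\<close>

lemma design_nonneg_poly_inner_nonzero:
  fixes z :: "real ^ 'n"
  assumes "spherical_design n \<omega>" "degree p \<le> n" "norm z = 1" "CARD('n) \<ge> 2"
    and "p \<noteq> 0" "\<And>s. s \<in> {-1..1} \<Longrightarrow> poly p s \<ge> 0"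
  shows "\<exists>x\<in>\<omega>. poly p (z \<bullet> x) \<noteq> 0"
proof (rule ccontr)
  assume "\<not> ?thesis"
  then have "(\<Sum>x\<in>\<omega>. poly p (z \<bullet> x)) = 0" by simp
  then have int: "(\<integral>x. poly p (z \<bullet> x) \<partial>sphere_measure) = 0"
    using assms(1) poly_fun_le_mono[OF poly_fun_le_poly_inner assms(2), of z]
    unfolding spherical_design_def by force
  have "poly p s = 0" if s: "s \<in> {-1..1}" for s
  proof -
    obtain x where x: "norm x = 1" "z \<bullet> x = s"
      using sphere_inner_surj[OF assms(4,3) s] by blast
    have "poly p (z \<bullet> x) = 0"
    proof (rule integral_sphere_measure_zero_imp_zero[OF _ _ int x(1)])
      show "continuous_on UNIV (\<lambda>x. poly p (z \<bullet> x))" by (intro continuous_intros)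
      fix y :: "real ^ 'n" assume "norm y = 1"
      then have "\<bar>z \<bullet> y\<bar> \<le> 1" using Cauchy_Schwarz_ineq2[of z y] assms(3) by simp
      then show "poly p (z \<bullet> y) \<ge> 0" by (intro assms(6)) auto
    qed
    then show ?thesis using x by simp
  qed
  then have "{-1..1} \<subseteq> {s. poly p s = 0}" by blast
  then have "finite {-1..1::real}" using poly_roots_finite[OF assms(5)] finite_subset by blast
  then show False using infinite_Icc[of "-1::real" 1] by simp
qed

section \<open>Strongly sharp configurations\<close>

text \<open>Only \<open>f 0\<close> can be infinite, and then the bound at 0 is trivial while
  \<open>g 0\<close> is the default value 0 of \<open>real_of_ereal\<close>; the real bound is
  therefore used only where \<open>f s\<close> is finite. At \<open>s = 4\<close> the two sides
  agree by interpolation.\<close>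

lemma hermite_lower_bound_ereal:
  fixes f :: "real \<Rightarrow> ereal"
  assumes ninf: "\<And>t. t \<in> {0..4} \<Longrightarrow> f t \<noteq> -\<infinity>"
    and fin: "\<And>t. t \<in> {0<..4} \<Longrightarrow> f t \<noteq> \<infinity>"
    and cont: "continuous_on {0<..4} f" "(f \<longlongrightarrow> f 0) (at_right 0)"
    and g_def: "g = (\<lambda>t. real_of_ereal (f t))"
    and diff: "\<And>k t. k < 2 * m - 1 \<Longrightarrow> t \<in> {0<..<4} \<Longrightarrow> (deriv ^^ k) g differentiable (at t)"
    and conc: "concave_on {0<..<4} ((deriv ^^ (2 * m - 1)) g)"
    and B: "finite B" "card B = m" "m \<ge> 1" "B \<subseteq> {0<..<4}"
    and p: "degree p \<le> 2 * m" "\<And>x. x \<in> insert 4 B \<Longrightarrow> poly p x = g x"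
      "\<And>x. x \<in> B \<Longrightarrow> poly (pderiv p) x = deriv g x"
    and s: "s \<in> {0..4}"
  shows "ereal (poly p s) \<le> f s"
    and "strictly_concave_on {0<..<4} ((deriv ^^ (2 * m - 1)) g) \<Longrightarrow> s \<notin> insert 4 B \<Longrightarrow>
      ereal (poly p s) < f s"
proof -
  let ?strict = "strictly_concave_on {0<..<4} ((deriv ^^ (2 * m - 1)) g)"
  have fg: "f t = ereal (g t)" if "t \<in> {0..4}" "f t \<noteq> \<infinity>" for t
    using ninf[OF that(1)] that(2) by (cases "f t") (auto simp: g_def)
  have contg: "continuous_on I g" if "continuous_on I f" "I \<subseteq> {0..4}" "\<And>t. t \<in> I \<Longrightarrow> f t \<noteq> \<infinity>" for I
  proof -
    have "\<bar>f t\<bar> \<noteq> \<infinity>" if "t \<in> I" for t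
      using \<open>t \<in> I\<close> \<open>I \<subseteq> {0..4}\<close> \<open>\<And>t. t \<in> I \<Longrightarrow> f t \<noteq> \<infinity>\<close>[of t] ninf[of t] by (cases "f t") auto
    then have "continuous_on I (real_of_ereal \<circ> f)"
      using that(1) by (subst continuous_on_iff_real[symmetric])
    then show ?thesis by (simp add: g_def comp_def)
  qed
  have key: "poly p s \<le> g s \<and> (?strict \<longrightarrow> s \<notin> B \<longrightarrow> poly p s < g s)"
    if s4: "s < 4" and sfin: "f s \<noteq> \<infinity>"
  proof -
    \<comment> \<open>Continuity of \<open>g\<close> at \<open>0\<close> is only available when \<open>f 0\<close> is finite, and only needed for \<open>s = 0\<close>.\<close>
    obtain I where I: "convex I" "continuous_on I g" "interior I = {0<..<4}" "s \<in> I" "4 \<in> I"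
    proof (cases "s = 0")
      case True
      have "continuous_on {0..4} f"
      proof (intro continuous_on_eq_continuous_within[THEN iffD2] ballI)
        fix t :: real assume t: "t \<in> {0..4}"
        show "continuous (at t within {0..4}) f"
        proof (cases "t = 0")
          case True
          have "(f \<longlongrightarrow> f 0) (at 0 within {0..4})"
            using cont(2) by (simp add: at_within_Icc_at_right)
          then show ?thesis by (simp add: True continuous_within)
        next
          case False
          then have "continuous (at t within {0<..4}) f"
            using t cont(1) by (simp add: continuous_on_eq_continuous_within)
          moreover have "at t within {0<..4} = at t within {0..4}"
            using t False by (intro at_within_nhd[of _ "{0<..}"]) auto
          ultimately show ?thesis by simp
        qed
      qed
      then have "continuous_on {0..4} g"
        using sfin fin True by (intro contg) (auto simp: less_le)
      then show ?thesis using s True by (intro that[of "{0..4}"]) auto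
    next
      case False
      have "interior {0<..4::real} = {0<..<4}"
        using interior_mono[of "{0<..4::real}" "{0..4}"] interior_maximal[of "{0<..<4}" "{0<..4::real}"]
        by fastforce
      moreover have "continuous_on {0<..4} g" using cont(1) fin by (intro contg) auto
      ultimately show ?thesis using s False by (intro that[of "{0<..4}"]) auto
    qed
    have "4 \<notin> B" using B by auto
    from hermite_lower_bound[OF I(1,2) _ B(1-3) _ I(5) this p _ I(4) s4]
    show ?thesis using diff B(4) conc I(3) by auto
  qed
  have four: "f 4 = ereal (poly p 4)" using fg[of 4] fin[of 4] p(2)[of 4] by simp
  show "ereal (poly p s) \<le> f s"
  proof (cases "f s = \<infinity> \<or> s = 4")
    case True
    then show ?thesis using four by auto
  next
    case False
    then show ?thesis using key fg[OF s] s by auto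
  qed
  show "ereal (poly p s) < f s" if ?strict "s \<notin> insert 4 B"
  proof (cases "f s = \<infinity>")
    case False
    then show ?thesis using key fg[OF s] s that by auto
  qed simp
qed

text \<open>One strict term suffices because the lower bounds are real: adding a finite number
  preserves strict inequality in \<open>ereal\<close>.\<close>

lemma sum_ereal_strict_mono:
  fixes F :: "'a \<Rightarrow> ereal" and h :: "'a \<Rightarrow> real"
  assumes "finite A" "\<And>x. x \<in> A \<Longrightarrow> ereal (h x) \<le> F x" "a \<in> A" "ereal (h a) < F a"
  shows "ereal (\<Sum>x\<in>A. h x) < (\<Sum>x\<in>A. F x)"
proof -
  have "ereal (\<Sum>x\<in>A. h x) = ereal (h a) + ereal (\<Sum>x\<in>A - {a}. h x)"
    using assms by (simp add: sum.remove[of A a])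
  also have "\<dots> < F a + ereal (\<Sum>x\<in>A - {a}. h x)"
    using assms(4) by (cases "F a") auto
  also have "\<dots> \<le> F a + (\<Sum>x\<in>A - {a}. F x)"
    unfolding sum_ereal[symmetric] using assms(2) by (intro add_left_mono sum_mono) auto
  also have "\<dots> = (\<Sum>x\<in>A. F x)"
    using assms by (simp add: sum.remove[of A a])
  finally show ?thesis .
qed

section \<open>Dot products of a strongly sharp configuration\<close>

definition inner_products :: "(real ^ 'n) set \<Rightarrow> real set" where
  "inner_products \<omega> = {x \<bullet> y | x y. x \<in> \<omega> \<and> y \<in> \<omega> \<and> x \<noteq> y}"

lemma strongly_sharp_inner_products:
  fixes \<omega> :: "(real ^ 'n) set"
  assumes sharp: "strongly_sharp_config m \<omega>" and dim: "CARD('n) \<ge> 2"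
  shows "inner_products \<omega> \<subseteq> {-1<..<1}"
    and "norm z = 1 \<Longrightarrow> \<exists>x\<in>\<omega>. - (z \<bullet> x) \<notin> inner_products \<omega>"
proof -
  let ?A = "inner_products \<omega>"
  have m: "m \<ge> 1" "card ?A = m" and des: "spherical_design (2 * m) \<omega>"
    using sharp by (auto simp: strongly_sharp_config_def sharp_config_def inner_products_def)
  have fin: "finite ?A" using m card.infinite by fastforce
  have \<omega>: "\<omega> \<subseteq> sphere 0 1" "\<omega> \<noteq> {}" using des by (auto simp: spherical_design_def)
  have norm1: "norm x = 1" if "x \<in> \<omega>" for x using \<omega> that by auto
  have A1: "\<bar>a\<bar> \<le> 1 \<and> a \<noteq> 1" if a: "a \<in> ?A" for a
  proof -
    obtain x y where xy: "a = x \<bullet> y" "x \<in> \<omega>" "y \<in> \<omega>" "x \<noteq> y"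
      using a unfolding inner_products_def by blast
    have "\<bar>x \<bullet> y\<bar> \<le> 1" using Cauchy_Schwarz_ineq2[of x y] norm1 xy by simp
    moreover have "x \<bullet> y \<noteq> 1"
    proof
      assume "x \<bullet> y = 1"
      then have "(norm (x - y))\<^sup>2 = 0"
        using norm1[OF xy(2)] norm1[OF xy(3)]
        by (simp add: power2_norm_eq_inner inner_diff inner_commute) (simp add: dot_square_norm)
      then show False using xy by simp
    qed
    ultimately show ?thesis using xy by simp
  qed
  show "\<exists>x\<in>\<omega>. - (z \<bullet> x) \<notin> ?A" if z: "norm z = 1"
  proof -
    \<comment> \<open>The factors are t + a, so the roots are the negatives of the dot
      products.\<close>
    define p where "p = (\<Prod>a\<in>?A. [:a, 1:])\<^sup>2"
    have "degree p \<le> 2 * m"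
      unfolding p_def using m by (subst degree_power_eq) (auto simp: degree_prod_sum_eq fin)
    moreover have "p \<noteq> 0" using fin by (auto simp: p_def)
    moreover have "poly p s \<ge> 0" for s by (simp add: p_def)
    ultimately obtain x where x: "x \<in> \<omega>" "poly p (z \<bullet> x) \<noteq> 0"
      using design_nonneg_poly_inner_nonzero[OF des _ z dim] by blast
    have "- (z \<bullet> x) \<notin> ?A"
    proof
      assume "- (z \<bullet> x) \<in> ?A"
      then have "poly p (z \<bullet> x) = 0"
        using fin by (auto simp: p_def poly_prod intro!: bexI[of _ "- (z \<bullet> x)"])
      then show False using x by simp
    qed
    then show ?thesis using x by blast
  qed
  have "-1 \<notin> ?A"
  proof
    assume neg: "-1 \<in> ?A"
    obtain z where z: "z \<in> \<omega>" using \<omega> by blast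
    \<comment> \<open>The factor 1 - t^2 takes care of \<open>x = z\<close> and of the dot product
      -1 with simple zeros; the other m-1 values need squares, which gives degree exactly
      2m.\<close>
    define p where "p = [:1, 0, -1:] * (\<Prod>a\<in>?A - {-1}. [:-a, 1:])\<^sup>2"
    have "degree ((\<Prod>a\<in>?A - {-1}. [:-a, 1:])\<^sup>2) = 2 * (m - 1)"
      using m fin neg by (subst degree_power_eq) (auto simp: degree_prod_sum_eq)
    then have "degree p \<le> 2 * m"
      unfolding p_def using m degree_mult_le[of "[:1, 0, -1:]" "(\<Prod>a\<in>?A - {-1}. [:-a, 1:])\<^sup>2"] by simp
    moreover have "p \<noteq> 0" unfolding p_def using fin by (intro no_zero_divisors) auto
    moreover have "poly p s \<ge> 0" if "s \<in> {-1..1}" for s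
    proof -
      have "poly [:1, 0, -1:] s = (1 - s) * (1 + s)" by (simp add: algebra_simps)
      also have "\<dots> \<ge> 0" using that by (intro mult_nonneg_nonneg) auto
      finally show ?thesis unfolding p_def poly_mult poly_power by (intro mult_nonneg_nonneg) auto
    qed
    ultimately obtain x where x: "x \<in> \<omega>" "poly p (z \<bullet> x) \<noteq> 0"
      using design_nonneg_poly_inner_nonzero[OF des _ norm1[OF z] dim] by blast
    have "poly p (z \<bullet> x) = 0"
    proof (cases "x = z")
      case True
      then show ?thesis using norm1[OF z] by (simp add: p_def dot_square_norm)
    next
      case False
      then have "z \<bullet> x \<in> ?A" using x z by (auto simp: inner_products_def)
      then show ?thesis using fin
        by (cases "z \<bullet> x = -1") (auto simp: p_def poly_prod)
    qed
    then show False using x by simp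
  qed
  then show "?A \<subseteq> {-1<..<1}" using A1 by (force simp: abs_le_iff less_le)
qed

section \<open>Minima of the potential\<close>

theorem theorem4p5:
  fixes m d :: nat
    and f :: "real \<Rightarrow> ereal"
    and g :: "real \<Rightarrow> real"
    and \<omega> :: "(real ^ 'n) set"
  assumes "m \<ge> 1" and "d \<ge> 1" and "CARD('n) = d + 1"
    and "\<And>t. t \<in> {0..4} \<Longrightarrow> f t \<noteq> -\<infinity>"
    and "\<And>t. t \<in> {0<..4} \<Longrightarrow> f t \<noteq> \<infinity>"
    and "continuous_on {0<..4} f"
    and "(f \<longlongrightarrow> f 0) (at_right 0)"
    and g_def: "g = (\<lambda>t. real_of_ereal (f t))"
    and "\<And>k t. k < 2 * m - 1 \<Longrightarrow> t \<in> {0<..<4} \<Longrightarrow> (deriv ^^ k) g differentiable (at t)"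
    and "concave_on {0<..<4} ((deriv ^^ (2 * m - 1)) g)"
    and "strongly_sharp_config m \<omega>"
  shows "(\<forall>z \<in> uminus ` \<omega>. is_arg_min (potential f \<omega>) (\<lambda>x. x \<in> sphere 0 1) z) \<and>
    (strictly_concave_on {0<..<4} ((deriv ^^ (2 * m - 1)) g) \<longrightarrow>
       (\<forall>z. is_arg_min (potential f \<omega>) (\<lambda>x. x \<in> sphere 0 1) z \<longrightarrow> z \<in> uminus ` \<omega>))"
proof -
  let ?strict = "strictly_concave_on {0<..<4} ((deriv ^^ (2 * m - 1)) g)"
  have dim: "CARD('n) \<ge> 2" using assms(2,3) by simp
  note A = strongly_sharp_inner_products[OF assms(11) dim]
  have cardA: "card (inner_products \<omega>) = m" and des: "spherical_design (2 * m) \<omega>"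
    using assms(11) by (auto simp: strongly_sharp_config_def sharp_config_def inner_products_def)
  have fin: "finite \<omega>" "\<omega> \<noteq> {}" and norm1: "\<And>x. x \<in> \<omega> \<Longrightarrow> norm x = 1"
    using des by (auto simp: spherical_design_def)
  define B where "B = (\<lambda>a. 2 + 2 * a) ` inner_products \<omega>"
  have cB: "card B = m"
    unfolding B_def cardA[symmetric] by (intro card_image) (auto simp: inj_on_def)
  \<comment> \<open>Dot products strictly between -1 and 1 give nodes strictly between 0 and 4,
    where \<open>g\<close> is differentiable.\<close>
  have B: "finite B" "B \<subseteq> {0<..<4}" "4 \<notin> B"
    using cB assms(1) A(1) card.infinite[of B] by (fastforce simp: B_def)+
  obtain p where p: "degree p \<le> 2 * m" "\<And>x. x \<in> insert 4 B \<Longrightarrow> poly p x = g x"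
      "\<And>x. x \<in> B \<Longrightarrow> poly (pderiv p) x = deriv g x"
    using hermite_interpolation_double_simple[OF B(1,3), of g "deriv g"] cB assms(1) by metis
  have bound: "ereal (poly p s) \<le> f s" if "s \<in> {0..4}" for s
    by (rule hermite_lower_bound_ereal(1)[OF assms(4-10) B(1) cB assms(1) B(2) p that])
  have bound_strict: "ereal (poly p s) < f s" if "s \<in> {0..4}" ?strict "s \<notin> insert 4 B" for s
    by (rule hermite_lower_bound_ereal(2)[OF assms(4-10) B(1) cB assms(1) B(2) p that])
  \<comment> \<open>On the sphere |x - y|^2 is 2 minus twice the dot product, so \<open>q\<close>
    expresses \<open>p\<close> in the dot product without raising the degree.\<close>
  define q where "q = pcompose p [:2, -2:]"
  have dist: "(norm (x - y))\<^sup>2 = 2 - 2 * (x \<bullet> y)" if "norm x = 1" "norm y = 1" for x y :: "real ^ 'n"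
    using that by (simp add: power2_norm_eq_inner inner_diff inner_commute) (simp add: dot_square_norm)
  have dist04: "(norm (x - y))\<^sup>2 \<in> {0..4}" if "norm x = 1" "norm y = 1" for x y :: "real ^ 'n"
    using Cauchy_Schwarz_ineq2[of x y] that by (auto simp: dist[OF that] abs_le_iff)
  have q: "poly p ((norm (x - y))\<^sup>2) = poly q (x \<bullet> y)" if "norm x = 1" "norm y = 1" for x y :: "real ^ 'n"
    by (simp add: q_def poly_pcompose dist[OF that] mult.commute)
  obtain x0 where x0: "x0 \<in> \<omega>" using fin by blast
  \<comment> \<open>The point \<open>x0\<close> only serves to name the constant: by the design
    property any unit vector gives the same sum.\<close>
  define C where "C = (\<Sum>y\<in>\<omega>. poly q (x0 \<bullet> y))"
  have "degree q \<le> 2 * m" using p(1) by (simp add: q_def degree_pcompose)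
  then have C: "(\<Sum>y\<in>\<omega>. poly p ((norm (z - y))\<^sup>2)) = C" if "norm z = 1" for z
    using design_sum_poly_inner[OF des _ that norm1[OF x0], of q] q that norm1
    by (simp add: C_def)
  have lower: "ereal C \<le> potential f \<omega> z" if z: "norm z = 1" for z
    unfolding potential_def C[OF z, symmetric] sum_ereal[symmetric]
    using bound dist04 norm1 z by (intro sum_mono) auto
  have attained: "potential f \<omega> (- x) = ereal C" if x: "x \<in> \<omega>" for x
  proof -
    have nx: "norm (- x) = 1" using norm1[OF x] by simp
    have "f ((norm (- x - y))\<^sup>2) = ereal (poly p ((norm (- x - y))\<^sup>2))" if y: "y \<in> \<omega>" for y
    proof -
      have "(norm (- x - y))\<^sup>2 \<in> insert 4 B"
      proof (cases "x = y")
        case True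
        then show ?thesis using dist[OF nx norm1[OF y]] norm1[OF x] by (simp add: dot_square_norm)
      next
        case False
        then have "x \<bullet> y \<in> inner_products \<omega>" using x y by (auto simp: inner_products_def)
        then show ?thesis using dist[OF nx norm1[OF y]] by (auto simp: B_def)
      qed
      \<comment> \<open>Nodes are positive, so \<open>f\<close> is finite there and \<open>g\<close>
        is its true value.\<close>
      moreover from this have "(norm (- x - y))\<^sup>2 \<in> {0<..4}" using B(2) by auto
      ultimately show ?thesis
        using p(2) assms(4,5) by (cases "f ((norm (- x - y))\<^sup>2)") (auto simp: g_def)
    qed
    then show ?thesis by (simp add: potential_def C[OF nx])
  qed
  have "is_arg_min (potential f \<omega>) (\<lambda>x. x \<in> sphere 0 1) (- x)" if "x \<in> \<omega>" for x
    using attained[OF that] lower norm1[OF that] by (auto simp: is_arg_min_def not_less)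
  moreover have "z \<in> uminus ` \<omega>"
    if strict: ?strict and min: "is_arg_min (potential f \<omega>) (\<lambda>x. x \<in> sphere 0 1) z" for z
  proof (rule ccontr)
    assume nz: "z \<notin> uminus ` \<omega>"
    have z: "norm z = 1" using min by (simp add: is_arg_min_def)
    \<comment> \<open>This \<open>y\<close> gives a strict term: its squared distance to
      \<open>z\<close> is no double node by choice, and is not 4 because \<open>z\<close> is
      antipodal to no point of the configuration.\<close>
    obtain y where y: "y \<in> \<omega>" "- (z \<bullet> y) \<notin> inner_products \<omega>" using A(2)[OF z] by blast
    have "(norm (z - y))\<^sup>2 \<notin> B"
      using y by (auto simp: B_def dist[OF z norm1[OF y(1)]])
    moreover have "(norm (z - y))\<^sup>2 \<noteq> 4"
    proof
      assume "(norm (z - y))\<^sup>2 = 4"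
      \<comment> \<open>By the parallelogram law |z - y|^2 + |z + y|^2 = 4.\<close>
      then have "(norm (z + y))\<^sup>2 = 0"
        using dist[of z "- y"] dist[of z y] z norm1[OF y(1)] by simp
      then have "z = - y" by (simp add: eq_neg_iff_add_eq_0)
      then show False using nz y by blast
    qed
    ultimately have "ereal (poly p ((norm (z - y))\<^sup>2)) < f ((norm (z - y))\<^sup>2)"
      using bound_strict[OF dist04[OF z norm1[OF y(1)]] strict] by simp
    then have "ereal C < potential f \<omega> z"
      unfolding potential_def C[OF z, symmetric]
      using bound dist04 norm1 z y(1) fin(1) by (intro sum_ereal_strict_mono[of \<omega> _ _ y]) auto
    then have "potential f \<omega> (- x0) < potential f \<omega> z" using attained[OF x0] by simp
    then show False using min norm1[OF x0] by (auto simp: is_arg_min_def)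
  qed
  ultimately show ?thesis by blast
qed

end
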